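(* Let $z_1,\dots,z_K\in\Omega$ be target points, $d_1,\dots,d_K>0$, and let $R_K=(d_1,\dots,d_K)$ be the reflecting surface with polar radius $$\tilde\rho(x)=\min_{1\le i\le K}\frac{d_i}{1-\varepsilon_i(\hat z_i\cdot x)},\qquad x\in\varGamma,$$ where $\hat z_i=z_i/|z_i|$ and $\varepsilon_i=\sqrt{1+d_i^2/|z_i|^2}-d_i/|z_i|$. Write $f_{z_i}(x;d_i)=d_i/(1-\varepsilon_i(\hat z_i\cdot x))$ and, for $0<\lambda<1$, consider the smooth approximation $$\tilde\rho_\lambda(x)=-\lambda\log\Bigl[\sum_{i=1}^K\exp\Bigl(-\frac{f_{z_i}(x;d_i)}{\lambda}\Bigr)\Bigr].$$ At $x\in\varGamma$, let $I^*=\{i: f_{z_i}(x;d_i)=\tilde\rho(x)\}$, let $m=|I^*|\ge 1$ be the number of minimizing indices, and let $\tau\ge0$ satisfy $\tau_j:=f_{z_j}(x;d_j)-\tilde\rho(x)\ge\tau$ for every $j\notin I^*$. Then $$|\tilde\rho_\lambda(x)-\tilde\rho(x)|\le\lambda\log m+C_1\lambda e^{-\tau/\lambda},$$ where the positive constant $C_1$ depends on $m$ and $K$. Moreover, if $m=1$, then $$|D\tilde\rho_\lambda(x)-D\tilde\rho(x)|\le C_2e^{-\tau/\lambda},$$ where $C_2>0$ depends on $K$ and on $f$ (the functions $f_{z_i}(\cdot;d_i)$).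
   Context: $S^n\subset\mathbb R^{n+1}$ is the unit sphere, $S^n_+=\{m\in S^n:m_{n+1}>0\}$, $\varGamma\subset S^n_+$ is compact, and $\Omega\subset P=\{z\in\mathbb R^{n+1}:z_{n+1}=h\}$ with fixed $h<0$. $D$ denotes the gradient in the coordinates $t=(t^1,\dots,t^n)$, $|t|<1$, on $S^n_+$ given by $x_k=t^k$ for $k\le n$ and $x_{n+1}=\sqrt{1-|t|^2}$; the functions on $\varGamma$ given by the formulas $f_{z_i}(x;d_i)=d_i/(1-\varepsilon_i(\hat z_i\cdot x))$ (with $\hat z_i=z_i/|z_i|$ and $\varepsilon_i=\sqrt{1+d_i^2/|z_i|^2}-d_i/|z_i|$), $\tilde\rho(x)=\min_{1\le i\le K}f_{z_i}(x;d_i)$ and $\tilde\rho_\lambda(x)=-\lambda\log\bigl[\sum_{i=1}^K\exp(-f_{z_i}(x;d_i)/\lambda)\bigr]$ are regarded as defined on $S^n_+$ by the same formulas when differentiating. *)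

theory Defs
  imports "HOL-Analysis.Analysis"
begin

text \<open>
  The space of dimension n + 1 is rendered as \<^typ>\<open>(real^'n) \<times> real\<close> with n = \<^term>\<open>CARD('n)\<close>;
  the second component is the last coordinate. The norm and inner product of the product type
  are the Euclidean ones.
\<close>

definition upper_hemisphere :: "((real^'n) \<times> real) set" where
  "upper_hemisphere = {x \<in> sphere 0 1. snd x > 0}"

definition target_plane :: "real \<Rightarrow> ((real^'n) \<times> real) set" where
  "target_plane h = {z. snd z = h}"

definition ecc :: "(real^'n) \<times> real \<Rightarrow> real \<Rightarrow> real" where
  "ecc z d = sqrt (1 + d\<^sup>2 / (norm z)\<^sup>2) - d / norm z"

definition f_hyp :: "(real^'n) \<times> real \<Rightarrow> real \<Rightarrow> (real^'n) \<times> real \<Rightarrow> real" where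
  "f_hyp z d x = d / (1 - ecc z d * ((z /\<^sub>R norm z) \<bullet> x))"

definition rho ::
    "nat \<Rightarrow> (nat \<Rightarrow> (real^'n) \<times> real) \<Rightarrow> (nat \<Rightarrow> real) \<Rightarrow> (real^'n) \<times> real \<Rightarrow> real" where
  "rho K z d x = (MIN i\<in>{1..K}. f_hyp (z i) (d i) x)"

definition rho_smooth ::
    "real \<Rightarrow> nat \<Rightarrow> (nat \<Rightarrow> (real^'n) \<times> real) \<Rightarrow> (nat \<Rightarrow> real) \<Rightarrow> (real^'n) \<times> real \<Rightarrow> real" where
  "rho_smooth lam K z d x = - lam * ln (\<Sum>i=1..K. exp (- f_hyp (z i) (d i) x / lam))"

definition argmin_set ::
    "nat \<Rightarrow> (nat \<Rightarrow> (real^'n) \<times> real) \<Rightarrow> (nat \<Rightarrow> real) \<Rightarrow> (real^'n) \<times> real \<Rightarrow> nat set" where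
  "argmin_set K z d x = {i \<in> {1..K}. f_hyp (z i) (d i) x = rho K z d x}"

definition chart :: "real^'n \<Rightarrow> (real^'n) \<times> real" where
  "chart t = (t, sqrt (1 - (norm t)\<^sup>2))"

text \<open>
  \<open>has_chart_gradient g x G\<close>: in the coordinates \<open>t\<close>, the function \<open>g\<close> is differentiable at
  the point \<open>x\<close> of the open upper hemisphere, with gradient \<open>G\<close> (necessarily unique).
  The coordinates of \<open>x\<close> are \<^term>\<open>fst x\<close>.
\<close>
definition has_chart_gradient ::
    "((real^'n) \<times> real \<Rightarrow> real) \<Rightarrow> (real^'n) \<times> real \<Rightarrow> real^'n \<Rightarrow> bool" where
  "has_chart_gradient g x G \<longleftrightarrow> (GDERIV (\<lambda>t. g (chart t)) (fst x) :> G)"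

end

theory Submission
  imports Defs
begin

text \<open>
  With \<open>w\<^sub>i = exp (- (f\<^sub>i - \<rho>) / \<lambda>)\<close> one has \<open>\<rho> - \<rho>\<^sub>\<lambda> = \<lambda> ln (\<Sum>\<^sub>i w\<^sub>i)\<close>; the minimizing
  indices contribute \<open>m\<close> to the sum and each other index at most \<open>exp (- \<tau> / \<lambda>)\<close>. The gradient of
  \<open>\<rho>\<^sub>\<lambda>\<close> is the average of the gradients \<open>D f\<^sub>i\<close> with weights proportional to \<open>w\<^sub>i\<close>. If there is
  a single minimizing index \<open>k\<close>, then \<open>\<rho> = f\<^sub>k\<close> near the point, and all weights but the \<open>k\<close>-th
  are at most \<open>exp (- \<tau> / \<lambda>)\<close>; the gradients \<open>D f\<^sub>i\<close> are bounded on the compact set \<open>\<Gamma>\<close>.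
\<close>

section \<open>Soft minima of finite families, kept free of geometry: values, then gradients\<close>

definition softmin :: "real \<Rightarrow> 'i set \<Rightarrow> ('i \<Rightarrow> real) \<Rightarrow> real" where
  "softmin lam I a = - lam * ln (\<Sum>i\<in>I. exp (- a i / lam))"

text \<open>Factoring \<open>exp (- r / lam)\<close> out of the sum makes the logarithm contribute
  exactly \<open>r\<close>. With \<open>r\<close> the minimum, all remaining exponents are
  nonpositive.\<close>

lemma softmin_diff:
  assumes "finite I" "I \<noteq> {}" "0 < lam"
  shows "softmin lam I a - r = - lam * ln (\<Sum>i\<in>I. exp (- (a i - r) / lam))"
proof -
  have "(\<Sum>i\<in>I. exp (- a i / lam)) = exp (- r / lam) * (\<Sum>i\<in>I. exp (- (a i - r) / lam))"
    unfolding sum_distrib_left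
    by (rule sum.cong) (auto simp: exp_add[symmetric] diff_divide_distrib)
  moreover have "(\<Sum>i\<in>I. exp (- (a i - r) / lam)) > 0"
    using assms by (intro sum_pos) auto
  ultimately show ?thesis
    using assms by (simp add: softmin_def ln_mult field_simps)
qed

lemma abs_softmin_diff_Min_le:
  fixes a :: "'i \<Rightarrow> real" and lam r \<tau> :: real
  assumes fin: "finite I" and ne: "I \<noteq> {}" and lam: "0 < lam"
    and r: "r = Min (a ` I)" and M: "M = {i \<in> I. a i = r}"
    and gap: "\<And>j. j \<in> I - M \<Longrightarrow> \<tau> \<le> a j - r"
  shows "\<bar>softmin lam I a - r\<bar> \<le> lam * ln (card M) + card I * lam * exp (- \<tau> / lam)"
proof -
  define S where "S = (\<Sum>i\<in>I - M. exp (- (a i - r) / lam))"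
  \<comment> \<open>The minimum is attained, so \<open>card M\<close> is at least 1. This makes
    \<open>ln (card M)\<close> meaningful, gives \<open>S / card M \<le> S\<close> and fixes the
    sign of \<open>ln (S + card M)\<close>.\<close>
  have "r \<in> a ` I" unfolding r using fin ne by (intro Min_in) auto
  then have "M \<noteq> {}" "M \<subseteq> I" "finite M" using fin by (auto simp: M)
  then have card: "1 \<le> real (card M)"
    using card_gt_0_iff[of M] by (simp add: Suc_le_eq)
  have "(\<Sum>i\<in>I. exp (- (a i - r) / lam)) = S + (\<Sum>i\<in>M. exp (- (a i - r) / lam))"
    unfolding S_def using \<open>M \<subseteq> I\<close> fin by (rule sum.subset_diff)
  also have "(\<Sum>i\<in>M. exp (- (a i - r) / lam)) = card M"
    by (simp add: M)
  finally have eq: "softmin lam I a - r = - lam * ln (S + card M)"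
    using softmin_diff[OF fin ne lam, of a r] by simp
  have S0: "0 \<le> S" unfolding S_def by (intro sum_nonneg) auto
  have "S \<le> card (I - M) * exp (- \<tau> / lam)"
    unfolding S_def
  proof (rule sum_bounded_above)
    show "exp (- (a i - r) / lam) \<le> exp (- \<tau> / lam)" if "i \<in> I - M" for i
      using gap[OF that] lam unfolding exp_le_cancel_iff by (intro divide_right_mono) auto
  qed
  also have "\<dots> \<le> card I * exp (- \<tau> / lam)"
    using fin by (intro mult_right_mono) (auto intro: card_mono)
  finally have S: "S \<le> card I * exp (- \<tau> / lam)" .
  \<comment> \<open>Pulling out \<open>card M\<close> isolates the term
    \<open>lam * ln (card M)\<close>; the inequality \<open>ln (1 + u) \<le> u\<close> then bounds
    what is left by \<open>S\<close>.\<close>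
  have "S + card M = card M * (1 + S / card M)"
    using card by (simp add: distrib_left)
  moreover have "0 < 1 + S / card M"
    using S0 by (intro add_pos_nonneg) auto
  ultimately have "ln (S + card M) = ln (card M) + ln (1 + S / card M)"
    using card ln_mult_pos[of "card M" "1 + S / card M"] by simp
  also have "ln (1 + S / card M) \<le> S / card M"
    using S0 card by (intro ln_add_one_self_le_self) auto
  also have "S / card M \<le> S"
    using divide_left_mono[OF card S0] card by simp
  finally have "ln (S + card M) \<le> ln (card M) + card I * exp (- \<tau> / lam)"
    using S by simp
  then have "lam * ln (S + card M) \<le> lam * (ln (card M) + card I * exp (- \<tau> / lam))"
    using lam by (intro mult_left_mono) auto
  \<comment> \<open>Since \<open>S + card M\<close> is at least 1, the difference is nonpositive and
    its absolute value is this very product.\<close>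
  moreover have "0 \<le> lam * ln (S + card M)"
    using lam S0 card by simp
  ultimately show ?thesis
    unfolding eq by (simp add: distrib_left mult_ac)
qed

text \<open>The chain rule yields an inner factor \<open>- 1 / lam\<close> and an outer factor
  \<open>- lam / W\<close>. Their scales cancel, leaving positive weights with sum 1.\<close>

lemma GDERIV_softmin:
  fixes g :: "'i \<Rightarrow> 'a::real_inner \<Rightarrow> real"
  assumes fin: "finite I" and ne: "I \<noteq> {}" and lam: "0 < lam"
    and g: "\<And>i. i \<in> I \<Longrightarrow> GDERIV (g i) t :> D i"
  shows "GDERIV (\<lambda>t. softmin lam I (\<lambda>i. g i t)) t :>
    (\<Sum>i\<in>I. (exp (- g i t / lam) / (\<Sum>j\<in>I. exp (- g j t / lam))) *\<^sub>R D i)"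
proof -
  define W where "W = (\<Sum>j\<in>I. exp (- g j t / lam))"
  have W: "W > 0" unfolding W_def using fin ne by (intro sum_pos) auto
  have "GDERIV (\<lambda>t. exp (- g i t / lam)) t :> (exp (- g i t / lam) * (- 1 / lam)) *\<^sub>R D i"
    if "i \<in> I" for i
  proof (rule GDERIV_DERIV_compose[OF g[OF that]])
    show "((\<lambda>s. exp (- s / lam)) has_real_derivative exp (- g i t / lam) * (- 1 / lam)) (at (g i t))"
      using lam by (auto intro!: derivative_eq_intros)
  qed
  then have "((\<lambda>t. \<Sum>i\<in>I. exp (- g i t / lam)) has_derivative
      (\<lambda>h. \<Sum>i\<in>I. h \<bullet> ((exp (- g i t / lam) * (- 1 / lam)) *\<^sub>R D i))) (at t)"
    unfolding gderiv_def by (rule has_derivative_sum)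
  then have S: "GDERIV (\<lambda>t. \<Sum>i\<in>I. exp (- g i t / lam)) t :>
      (\<Sum>i\<in>I. (exp (- g i t / lam) * (- 1 / lam)) *\<^sub>R D i)"
    unfolding gderiv_def inner_sum_right .
  have "((\<lambda>s. - lam * ln s) has_real_derivative - lam / W) (at (\<Sum>i\<in>I. exp (- g i t / lam)))"
    unfolding W_def[symmetric] using W by (auto intro!: derivative_eq_intros)
  from GDERIV_DERIV_compose[OF S this]
  have "GDERIV (\<lambda>t. softmin lam I (\<lambda>i. g i t)) t :>
      (- lam / W) *\<^sub>R (\<Sum>i\<in>I. (exp (- g i t / lam) * (- 1 / lam)) *\<^sub>R D i)"
    unfolding softmin_def .
  also have "(- lam / W) *\<^sub>R (\<Sum>i\<in>I. (exp (- g i t / lam) * (- 1 / lam)) *\<^sub>R D i)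
      = (\<Sum>i\<in>I. (exp (- g i t / lam) / W) *\<^sub>R D i)"
    unfolding scaleR_sum_right using lam by (intro sum.cong) auto
  finally show ?thesis unfolding W_def .
qed

text \<open>A minimum has no kink where one function is strictly smallest: by continuity the
  finitely many strict inequalities persist nearby, so the minimum agrees with \<open>g k\<close>
  there.\<close>

lemma GDERIV_Min:
  fixes g :: "'i \<Rightarrow> 'a::real_inner \<Rightarrow> real"
  assumes fin: "finite I" and k: "k \<in> I"
    and g: "\<And>i. i \<in> I \<Longrightarrow> GDERIV (g i) t :> D i"
    and less: "\<And>i. i \<in> I - {k} \<Longrightarrow> g k t < g i t"
  shows "GDERIV (\<lambda>t. Min ((\<lambda>i. g i t) ` I)) t :> D k"
proof -
  have cont: "(g i \<longlongrightarrow> g i t) (at t)" if "i \<in> I" for i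
    using has_derivative_continuous[OF g[OF that, unfolded gderiv_def]]
    by (simp add: continuous_at)
  have "\<forall>\<^sub>F s in at t. g k s < g i s" if "i \<in> I - {k}" for i
    using order_tendstoD(1)[OF tendsto_diff[OF cont cont], of i k 0] that k less by simp
  then have "\<forall>\<^sub>F s in at t. \<forall>i\<in>I - {k}. g k s < g i s"
    using fin by (intro eventually_ball_finite) auto
  moreover have Min: "g k s = Min ((\<lambda>i. g i s) ` I)" if "\<forall>i\<in>I - {k}. g k s < g i s" for s
  proof (rule Min_eqI[symmetric])
    show "g k s \<le> y" if "y \<in> (\<lambda>i. g i s) ` I" for y
    proof -
      obtain i where "i \<in> I" "y = g i s" using \<open>y \<in> _\<close> by auto
      then show ?thesis
        using \<open>\<forall>i\<in>I - {k}. g k s < g i s\<close> by (cases "i = k") (auto intro: less_imp_le)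
    qed
  qed (use fin k in auto)
  ultimately have ev: "\<forall>\<^sub>F s in at t. g k s = Min ((\<lambda>i. g i s) ` I)"
    by (rule eventually_mono)
  \<comment> \<open>The filter \<open>at t\<close> leaves out \<open>t\<close> itself, so the
    agreement at the point is supplied separately.\<close>
  have "g k t = Min ((\<lambda>i. g i t) ` I)"
    using less by (intro Min) auto
  then show ?thesis
    using has_derivative_transform_eventually[OF g[OF k, unfolded gderiv_def] ev]
    by (simp add: gderiv_def)
qed

text \<open>As the weights sum to 1, \<open>D k\<close> can be moved inside the average. The
  \<open>k\<close>-th term then vanishes, and the others have weight at most
  \<open>exp (- \<tau> / lam)\<close> because \<open>W\<close> contains the summand
  \<open>exp (- a k / lam)\<close>.\<close>

lemma norm_softmax_average_diff_le:
  fixes D :: "'i \<Rightarrow> 'a::real_normed_vector" and lam \<tau> B :: real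
  assumes fin: "finite I" and k: "k \<in> I" and lam: "0 < lam"
    and gap: "\<And>j. j \<in> I - {k} \<Longrightarrow> \<tau> \<le> a j - a k"
    and B: "\<And>i. i \<in> I \<Longrightarrow> norm (D i) \<le> B"
  shows "norm ((\<Sum>i\<in>I. (exp (- a i / lam) / (\<Sum>j\<in>I. exp (- a j / lam))) *\<^sub>R D i) - D k)
    \<le> card I * (2 * B) * exp (- \<tau> / lam)"
proof -
  define W where "W = (\<Sum>j\<in>I. exp (- a j / lam))"
  have Wk: "exp (- a k / lam) \<le> W"
    unfolding W_def using fin k by (intro member_le_sum) auto
  then have W: "W > 0" by (meson exp_gt_zero less_le_trans)
  have B0: "0 \<le> B" using B[OF k] norm_ge_zero order_trans by blast
  have "D k = (\<Sum>i\<in>I. (exp (- a i / lam) / W) *\<^sub>R D k)"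
    using W unfolding scaleR_left.sum[symmetric] sum_divide_distrib[symmetric] W_def[symmetric]
    by simp
  then have "norm ((\<Sum>i\<in>I. (exp (- a i / lam) / W) *\<^sub>R D i) - D k)
      = norm (\<Sum>i\<in>I. (exp (- a i / lam) / W) *\<^sub>R (D i - D k))"
    unfolding scaleR_right_diff_distrib sum_subtractf by simp
  also have "\<dots> \<le> card I * (exp (- \<tau> / lam) * (2 * B))"
  proof (intro sum_norm_bound)
    fix i assume i: "i \<in> I"
    show "norm ((exp (- a i / lam) / W) *\<^sub>R (D i - D k)) \<le> exp (- \<tau> / lam) * (2 * B)"
    proof (cases "i = k")
      case False
      have "exp (- a i / lam) / W \<le> exp (- a i / lam) / exp (- a k / lam)"
        using Wk by (intro divide_left_mono) (auto simp: W)
      also have "\<dots> = exp (- (a i - a k) / lam)"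
        by (simp add: exp_diff[symmetric] diff_divide_distrib)
      also have "\<dots> \<le> exp (- \<tau> / lam)"
        using gap[of i] i False lam unfolding exp_le_cancel_iff
        by (intro divide_right_mono) auto
      finally have "exp (- a i / lam) / W \<le> exp (- \<tau> / lam)" .
      moreover have "norm (D i - D k) \<le> 2 * B"
        using norm_triangle_ineq4[of "D i" "D k"] B[OF i] B[OF k] by linarith
      ultimately have "exp (- a i / lam) / W * norm (D i - D k) \<le> exp (- \<tau> / lam) * (2 * B)"
        by (intro mult_mono) auto
      then show ?thesis using W by simp
    qed (use B0 in simp)
  qed
  finally show ?thesis by (simp add: W_def mult_ac)
qed

section \<open>The functions \<open>f_hyp\<close> and their gradients in the chart\<close>

lemma ecc_bounds:
  assumes "z \<noteq> 0" "d > 0"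
  shows "0 < ecc z d" "ecc z d < 1"
proof -
  define a where "a = d / norm z"
  have a: "a > 0" using assms by (simp add: a_def)
  have e: "ecc z d = sqrt (1 + a\<^sup>2) - a" by (simp add: ecc_def a_def power_divide)
  show "0 < ecc z d" unfolding e using a by (simp add: real_less_rsqrt)
  have "sqrt (1 + a\<^sup>2) < 1 + a"
    using a by (intro real_less_lsqrt) (auto simp: power2_eq_square algebra_simps)
  then show "ecc z d < 1" unfolding e by simp
qed

text \<open>Cauchy-Schwarz bounds the inner product of the two unit vectors by 1, and the
  eccentricity lies strictly between 0 and 1.\<close>

lemma f_hyp_denominator_pos:
  assumes "z \<noteq> 0" "d > 0" "norm x = 1"
  shows "0 < 1 - ecc z d * ((z /\<^sub>R norm z) \<bullet> x)"
proof -
  have "(z /\<^sub>R norm z) \<bullet> x \<le> 1"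
    using norm_cauchy_schwarz[of "z /\<^sub>R norm z" x] assms by simp
  then have "ecc z d * ((z /\<^sub>R norm z) \<bullet> x) \<le> ecc z d * 1"
    using ecc_bounds[OF assms(1,2)] by (intro mult_left_mono) auto
  then show ?thesis using ecc_bounds(2)[OF assms(1,2)] by simp
qed

lemma upper_hemisphereD:
  assumes "x \<in> upper_hemisphere"
  shows "norm x = 1" "snd x > 0" "sqrt (1 - (norm (fst x))\<^sup>2) = snd x"
    "chart (fst x) = x"
proof -
  show 1: "norm x = 1" and 2: "snd x > 0"
    using assms by (auto simp: upper_hemisphere_def)
  have 3: "(norm (fst x))\<^sup>2 + (snd x)\<^sup>2 = 1"
    using 1 by (cases x) (simp add: norm_Pair)
  show 4: "sqrt (1 - (norm (fst x))\<^sup>2) = snd x"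
    using 3 2 by (intro real_sqrt_unique) auto
  show "chart (fst x) = x" by (simp add: chart_def 4)
qed

text \<open>The vector factor is the chart gradient of the inner product of \<open>z\<close> with
  the point: as \<open>t\<close> varies, the last coordinate has gradient
  \<open>- fst x / snd x\<close>. The scalar factor is the derivative of
  \<open>d / (1 - ecc z d * s)\<close> in \<open>s\<close>, with \<open>1 / norm z\<close> from
  normalizing \<open>z\<close>.\<close>

definition f_hyp_gradient :: "(real^'n) \<times> real \<Rightarrow> real \<Rightarrow> (real^'n) \<times> real \<Rightarrow> real^'n" where
  "f_hyp_gradient z d x =
    (d * ecc z d / (norm z * (1 - ecc z d * ((z /\<^sub>R norm z) \<bullet> x))\<^sup>2)) *\<^sub>R
      (fst z - (snd z / snd x) *\<^sub>R fst x)"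

lemma has_chart_gradient_f_hyp:
  assumes "z \<noteq> 0" "d > 0" and x: "x \<in> upper_hemisphere"
  shows "has_chart_gradient (f_hyp z d) x (f_hyp_gradient z d x)"
proof -
  let ?t = "fst x"
  note ux = upper_hemisphereD[OF x]
  define N where "N = 1 - ecc z d * ((z /\<^sub>R norm z) \<bullet> x)"
  have N: "N > 0" unfolding N_def using assms ux by (intro f_hyp_denominator_pos) auto
  \<comment> \<open>Strict positivity of the radicand keeps the square root in \<open>chart\<close>
    away from its singularity at 0.\<close>
  have pos: "0 < 1 - ?t \<bullet> ?t"
    using ux(3) ux(2) by (metis power2_norm_eq_inner real_sqrt_gt_0_iff)
  have sq: "sqrt (1 - ?t \<bullet> ?t) = snd x" using ux(3) by (simp add: power2_norm_eq_inner)
  have chart: "(chart has_derivative (\<lambda>h. (h, - (?t \<bullet> h) / snd x))) (at ?t)"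
    unfolding chart_def power2_norm_eq_inner using pos
    by (auto intro!: derivative_eq_intros simp: sq fun_eq_iff inner_commute field_simps)
  define u where "u = (\<lambda>t. (z /\<^sub>R norm z) \<bullet> chart t)"
  have "(u has_derivative (\<lambda>h. (z /\<^sub>R norm z) \<bullet> (h, - (?t \<bullet> h) / snd x))) (at ?t)"
    unfolding u_def by (intro has_derivative_inner_right chart)
  \<comment> \<open>The last coordinate's contribution is absorbed into the first component, giving
    the form \<open>h \<bullet> G\<close> that \<open>GDERIV\<close> demands.\<close>
  also have "(\<lambda>h. (z /\<^sub>R norm z) \<bullet> (h, - (?t \<bullet> h) / snd x))
     = (\<lambda>h. h \<bullet> (inverse (norm z) *\<^sub>R (fst z - (snd z / snd x) *\<^sub>R ?t)))"
    by (cases z) (simp add: fun_eq_iff inner_diff_right inner_commute right_diff_distrib)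
  finally have u: "GDERIV u ?t :> inverse (norm z) *\<^sub>R (fst z - (snd z / snd x) *\<^sub>R ?t)"
    by (simp add: gderiv_def)
  have v: "((\<lambda>s. d / (1 - ecc z d * s)) has_real_derivative d * ecc z d / N\<^sup>2) (at (u ?t))"
    using N by (auto intro!: derivative_eq_intros simp: u_def ux(4) N_def power2_eq_square)
  have "f_hyp_gradient z d x =
      (d * ecc z d / N\<^sup>2) *\<^sub>R (inverse (norm z) *\<^sub>R (fst z - (snd z / snd x) *\<^sub>R ?t))"
    unfolding f_hyp_gradient_def N_def[symmetric] scaleR_scaleR by (simp add: divide_inverse)
  then show ?thesis
    using GDERIV_DERIV_compose[OF u v] unfolding has_chart_gradient_def f_hyp_def u_def by simp
qed

text \<open>The explicit gradient may blow up as \<open>snd x\<close> tends to 0; on a compact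
  subset of the open hemisphere it is continuous, hence bounded. This makes the gradient estimate
  uniform in \<open>x\<close>.\<close>

lemma f_hyp_gradient_bounded:
  assumes "compact \<Gamma>" "\<Gamma> \<subseteq> upper_hemisphere" "z \<noteq> 0" "d > 0"
  obtains B where "\<And>x. x \<in> \<Gamma> \<Longrightarrow> norm (f_hyp_gradient z d x) \<le> B"
proof -
  have "snd x \<noteq> 0" "1 - ecc z d * ((z /\<^sub>R norm z) \<bullet> x) \<noteq> 0" if "x \<in> \<Gamma>" for x
    using upper_hemisphereD[of x] f_hyp_denominator_pos[of z d x] that assms by force+
  then have "continuous_on \<Gamma> (f_hyp_gradient z d)"
    unfolding f_hyp_gradient_def using assms by (intro continuous_intros) auto
  then have "bounded (f_hyp_gradient z d ` \<Gamma>)"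
    using assms compact_continuous_image compact_imp_bounded by blast
  then show ?thesis using that by (auto simp: bounded_iff)
qed

section \<open>The two estimates for the reflecting surface\<close>

theorem theorem3p1:
  shows "\<exists>C1 :: nat \<Rightarrow> nat \<Rightarrow> real.
    (\<forall>m K. C1 m K > 0) \<and>
    (\<forall>(h::real) (\<Gamma> :: ((real^'n) \<times> real) set) (\<Omega> :: ((real^'n) \<times> real) set)
      (K::nat) (z :: nat \<Rightarrow> (real^'n) \<times> real) (d :: nat \<Rightarrow> real).
      h < 0 \<longrightarrow> compact \<Gamma> \<longrightarrow> \<Gamma> \<subseteq> upper_hemisphere \<longrightarrow> \<Omega> \<subseteq> target_plane h \<longrightarrow>
      K \<ge> 1 \<longrightarrow> (\<forall>i\<in>{1..K}. z i \<in> \<Omega>) \<longrightarrow> (\<forall>i\<in>{1..K}. d i > 0) \<longrightarrow>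
      (\<forall>x\<in>\<Gamma>. \<forall>lam \<tau> m.
         0 < lam \<longrightarrow> lam < 1 \<longrightarrow> m = card (argmin_set K z d x) \<longrightarrow> \<tau> \<ge> 0 \<longrightarrow>
         (\<forall>j\<in>{1..K} - argmin_set K z d x. f_hyp (z j) (d j) x - rho K z d x \<ge> \<tau>) \<longrightarrow>
         \<bar>rho_smooth lam K z d x - rho K z d x\<bar>
           \<le> lam * ln (real m) + C1 m K * lam * exp (- \<tau> / lam)) \<and>
      (\<exists>C2>0. \<forall>x\<in>\<Gamma>. \<forall>lam \<tau>.
         0 < lam \<longrightarrow> lam < 1 \<longrightarrow> card (argmin_set K z d x) = 1 \<longrightarrow> \<tau> \<ge> 0 \<longrightarrow>
         (\<forall>j\<in>{1..K} - argmin_set K z d x. f_hyp (z j) (d j) x - rho K z d x \<ge> \<tau>) \<longrightarrow>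
         (\<exists>G_lam G. has_chart_gradient (rho_smooth lam K z d) x G_lam \<and>
            has_chart_gradient (rho K z d) x G \<and>
            norm (G_lam - G) \<le> C2 * exp (- \<tau> / lam))))"
\<comment> \<open>The estimate itself gives the constant \<open>card {1..K}\<close>, that is
  \<open>K\<close>; the added 1 keeps the witness positive at \<open>K = 0\<close> too.\<close>
proof (intro exI[of _ "\<lambda>m K. real K + 1"] conjI allI impI ballI)
  fix h :: real and \<Gamma> \<Omega> :: "((real^'n) \<times> real) set" and K :: nat
    and z :: "nat \<Rightarrow> (real^'n) \<times> real" and d :: "nat \<Rightarrow> real"
  assume "h < 0" and \<Gamma>: "compact \<Gamma>" "\<Gamma> \<subseteq> upper_hemisphere" and "\<Omega> \<subseteq> target_plane h"
    and K: "K \<ge> 1" and "\<forall>i\<in>{1..K}. z i \<in> \<Omega>" and d: "\<forall>i\<in>{1..K}. d i > 0"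
  \<comment> \<open>The last coordinate of every target is \<open>h\<close>, which is
    negative.\<close>
  then have z: "\<forall>i\<in>{1..K}. z i \<noteq> 0" by (force simp: target_plane_def)
  let ?f = "\<lambda>x i. f_hyp (z i) (d i) x"
  have smooth: "rho_smooth lam K z d = (\<lambda>x. softmin lam {1..K} (?f x))" for lam :: real
    by (simp add: rho_smooth_def softmin_def fun_eq_iff)
  have ne: "{1..K} \<noteq> {}" using K by simp
  {
    fix x and lam \<tau> :: real and m
    assume "0 < lam" "m = card (argmin_set K z d x)"
      and "\<forall>j\<in>{1..K} - argmin_set K z d x. ?f x j - rho K z d x \<ge> \<tau>"
    then have "\<bar>rho_smooth lam K z d x - rho K z d x\<bar>
        \<le> lam * ln (real m) + card {1..K} * lam * exp (- \<tau> / lam)"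
      using abs_softmin_diff_Min_le[OF finite_atLeastAtMost ne \<open>0 < lam\<close>
          rho_def argmin_set_def[of K z d x], of \<tau>]
      unfolding smooth by blast
    moreover have "0 \<le> lam * exp (- \<tau> / lam)" using \<open>0 < lam\<close> by simp
    ultimately show "\<bar>rho_smooth lam K z d x - rho K z d x\<bar>
        \<le> lam * ln (real m) + (real K + 1) * lam * exp (- \<tau> / lam)"
      by (simp add: algebra_simps)
  }
  define D where "D x i = f_hyp_gradient (z i) (d i) x" for x i
  have "\<forall>i\<in>{1..K}. \<exists>B. \<forall>x\<in>\<Gamma>. norm (D x i) \<le> B"
    unfolding D_def using f_hyp_gradient_bounded[OF \<Gamma>] z d by metis
  then obtain b where b: "\<And>i x. i \<in> {1..K} \<Longrightarrow> x \<in> \<Gamma> \<Longrightarrow> norm (D x i) \<le> b i"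
    by metis
  \<comment> \<open>The sum dominates every \<open>b i\<close> simultaneously, and the summand 1
    makes \<open>B\<close>, and with it \<open>C2\<close>, strictly positive.\<close>
  define B where "B = 1 + (\<Sum>i=1..K. \<bar>b i\<bar>)"
  have B: "norm (D x i) \<le> B" if "i \<in> {1..K}" "x \<in> \<Gamma>" for i x
  proof -
    have "\<bar>b i\<bar> \<le> (\<Sum>i=1..K. \<bar>b i\<bar>)" using that by (intro member_le_sum) auto
    then show ?thesis using b[OF that] by (simp add: B_def)
  qed
  have "B > 0" by (simp add: B_def sum_nonneg add_pos_nonneg)
  show "\<exists>C2>0. \<forall>x\<in>\<Gamma>. \<forall>lam \<tau>.
         0 < lam \<longrightarrow> lam < 1 \<longrightarrow> card (argmin_set K z d x) = 1 \<longrightarrow> \<tau> \<ge> 0 \<longrightarrow>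
         (\<forall>j\<in>{1..K} - argmin_set K z d x. f_hyp (z j) (d j) x - rho K z d x \<ge> \<tau>) \<longrightarrow>
         (\<exists>G_lam G. has_chart_gradient (rho_smooth lam K z d) x G_lam \<and>
            has_chart_gradient (rho K z d) x G \<and>
            norm (G_lam - G) \<le> C2 * exp (- \<tau> / lam))"
  \<comment> \<open>\<open>B\<close> was fixed before \<open>x\<close>, \<open>lam\<close> and
    \<open>\<tau>\<close>, so this witness depends only on \<open>K\<close> and on gradient bounds
    over \<Gamma>.\<close>
  proof (intro exI[of _ "card {1..K} * (2 * B)"] conjI ballI allI impI)
    show "0 < card {1..K} * (2 * B)" using K \<open>B > 0\<close> by simp
    fix x and lam \<tau> :: real
    assume x: "x \<in> \<Gamma>" and lam: "0 < lam" and "card (argmin_set K z d x) = 1"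
      and gap: "\<forall>j\<in>{1..K} - argmin_set K z d x. ?f x j - rho K z d x \<ge> \<tau>"
    then obtain k where k: "argmin_set K z d x = {k}" by (auto simp: card_1_singleton_iff)
    then have "k \<in> argmin_set K z d x" by simp
    then have kI: "k \<in> {1..K}" and rho: "rho K z d x = ?f x k"
      unfolding argmin_set_def by auto
    \<comment> \<open>Strictness comes from uniqueness of the minimizer; the gap hypothesis cannot
      give it when \<open>\<tau> = 0\<close>.\<close>
    have less: "?f x k < ?f x i" if "i \<in> {1..K} - {k}" for i
    proof -
      have "rho K z d x \<le> ?f x i" unfolding rho_def using that by (intro Min_le) auto
      moreover have "?f x i \<noteq> rho K z d x" using k that unfolding argmin_set_def by blast
      ultimately show ?thesis using rho by simp
    qed
    have xu: "x \<in> upper_hemisphere" using x \<Gamma> by blast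
    have ch: "chart (fst x) = x" by (rule upper_hemisphereD(4)[OF xu])
    have g: "GDERIV (\<lambda>t. ?f (chart t) i) (fst x) :> D x i" if "i \<in> {1..K}" for i
      using has_chart_gradient_f_hyp[OF _ _ xu, of "z i" "d i"] z d that
      by (simp add: has_chart_gradient_def D_def)
    let ?G = "\<Sum>i\<in>{1..K}. (exp (- ?f x i / lam) / (\<Sum>j\<in>{1..K}. exp (- ?f x j / lam))) *\<^sub>R D x i"
    have "has_chart_gradient (rho_smooth lam K z d) x ?G"
      unfolding has_chart_gradient_def smooth
      using GDERIV_softmin[OF _ ne lam g] by (simp add: ch)
    moreover have "has_chart_gradient (rho K z d) x (D x k)"
      unfolding has_chart_gradient_def rho_def
      by (rule GDERIV_Min[OF _ kI g]) (use less in \<open>auto simp: ch\<close>)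
    moreover have "norm (?G - D x k) \<le> card {1..K} * (2 * B) * exp (- \<tau> / lam)"
      by (rule norm_softmax_average_diff_le[OF _ kI lam]) (use gap k rho B x in auto)
    ultimately show "\<exists>G_lam G. has_chart_gradient (rho_smooth lam K z d) x G_lam \<and>
            has_chart_gradient (rho K z d) x G \<and>
            norm (G_lam - G) \<le> card {1..K} * (2 * B) * exp (- \<tau> / lam)"
      by blast
  qed
qed simp

end
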